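(* Let $N\ge 1$ and, for $j\in\{1,\dots,N\}$, let $\alpha^{(x)}_j,\alpha^{(y)}_j,\beta_j\in\mathbb{R}$ satisfy $\mathrm{sign}(\alpha^{(x)}_j)=\mathrm{sign}(\alpha^{(y)}_j)$ and $\alpha^{(x)}_j\alpha^{(y)}_j>\beta_j^2$. Let $\sigma>0$ be a constant and consider the linear layer system on $\mathbb{R}^2$ $$\mathrm{i}\,\partial_t u_j+\left(\alpha^{(x)}_jD_{x,j}^2+\alpha^{(y)}_jD_{y,j}^2+\beta_jD_{x,j}D_{y,j}\right)u_j=0,\qquad j\in\{1,\dots,N\},$$ where $$D_{x,j}=\frac{1}{1+e^{\mathrm{i}\pi/4}\sigma}\left(\partial_x-e^{\mathrm{i}\pi/4}\frac{\beta_j}{2\alpha^{(x)}_j}\sigma\,\partial_y\right),\qquad D_{y,j}=\frac{1}{1+e^{\mathrm{i}\pi/4}\sigma}\left(\partial_y-e^{\mathrm{i}\pi/4}\frac{\beta_j}{2\alpha^{(y)}_j}\sigma\,\partial_x\right).$$ Put $\tilde\beta_j=|\alpha^{(x)}_j|^{-1/2}|\alpha^{(y)}_j|^{-1/2}\beta_j$ and, for $0<b<1$, $\sigma_1(b)=\frac{\sqrt2}{4b}\left(2-b+\sqrt{b^2+12b+4}\right)$, with $\sigma_1(0)=+\infty$. If $$0<\sigma<\sigma_1\left(\max_{j\in\{1,\dots,N\}}|\tilde\beta_j|\right),$$ then the system is stable, i.e. $\mathrm{Re}\,\nu_j(k_x,k_y)\le0$ for all $(k_x,k_y)\in\mathbb{R}^2$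 and all $j\in\{1,\dots,N\}$.
   Context: For each $j$, the Fourier growth rate $\nu_j(k_x,k_y)$ is the complex number such that taking the Fourier transform in $(x,y)$ with dual variables $(k_x,k_y)\in\mathbb{R}^2$ (so that $\partial_x\to \mathrm{i}k_x$, $\partial_y\to\mathrm{i}k_y$) turns the $j$-th equation into $\partial_t\hat u_j=\nu_j(k_x,k_y)\hat u_j$. Stability means boundedness in time of all Fourier modes, i.e. all $\mathrm{Re}\,\nu_j\le 0$. The numbers $\tilde\beta_j$ are the mixed-derivative coefficients obtained by rescaling $x$ and $y$ in each equation separately so as to normalize the coefficients of the non-mixed derivatives to $1$.
   Formalization: The coefficients α_j^(x) (hence α_j^(y)) are assumed positive; with both negative the claim fails, e.g. N=1, α^(x)=α^(y)=-1, β=0, σ=1, (k_x,k_y)=(1,0) gives Re ν>0, since flipping all signs replaces ν by -ν. *)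

theory Defs
  imports "HOL-Analysis.Analysis"
begin

section \<open>Partial derivatives and the Fourier transform on the plane\<close>

type_synonym field2 = "real \<Rightarrow> real \<Rightarrow> complex"

definition partial_x :: "field2 \<Rightarrow> field2" where
  "partial_x f = (\<lambda>x y. vector_derivative (\<lambda>s. f s y) (at x))"

definition partial_y :: "field2 \<Rightarrow> field2" where
  "partial_y f = (\<lambda>x y. vector_derivative (\<lambda>s. f x s) (at y))"

definition partial_t :: "(real \<Rightarrow> field2) \<Rightarrow> real \<Rightarrow> field2" where
  "partial_t u = (\<lambda>t x y. vector_derivative (\<lambda>s. u s x y) (at t))"

text \<open>The sign in the exponent is the one for which \<open>partial_x\<close> becomes
  multiplication by \<open>\<i> * kx\<close>; the normalization of the integral is immaterial below.\<close>

definition fourier :: "field2 \<Rightarrow> real \<Rightarrow> real \<Rightarrow> complex" where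
  "fourier f kx ky =
     (LINT z|lborel. exp (- \<i> * complex_of_real (kx * fst z + ky * snd z)) * f (fst z) (snd z))"

section \<open>The layer system\<close>

definition layer_Dx :: "real \<Rightarrow> real \<Rightarrow> real \<Rightarrow> field2 \<Rightarrow> field2" where
  "layer_Dx ax b \<sigma> f = (\<lambda>x y.
     1 / (1 + exp (\<i> * pi / 4) * complex_of_real \<sigma>) *
     (partial_x f x y
        - exp (\<i> * pi / 4) * complex_of_real (b / (2 * ax)) * complex_of_real \<sigma> * partial_y f x y))"

definition layer_Dy :: "real \<Rightarrow> real \<Rightarrow> real \<Rightarrow> field2 \<Rightarrow> field2" where
  "layer_Dy ay b \<sigma> f = (\<lambda>x y.
     1 / (1 + exp (\<i> * pi / 4) * complex_of_real \<sigma>) *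
     (partial_y f x y
        - exp (\<i> * pi / 4) * complex_of_real (b / (2 * ay)) * complex_of_real \<sigma> * partial_x f x y))"

text \<open>The left-hand side of one equation of the layer system.\<close>

definition layer_lhs ::
  "real \<Rightarrow> real \<Rightarrow> real \<Rightarrow> real \<Rightarrow> (real \<Rightarrow> field2) \<Rightarrow> real \<Rightarrow> field2" where
  "layer_lhs ax ay b \<sigma> u t = (\<lambda>x y.
     \<i> * partial_t u t x y
     + (complex_of_real ax * layer_Dx ax b \<sigma> (layer_Dx ax b \<sigma> (u t)) x y
        + complex_of_real ay * layer_Dy ay b \<sigma> (layer_Dy ay b \<sigma> (u t)) x y
        + complex_of_real b * layer_Dx ax b \<sigma> (layer_Dy ay b \<sigma> (u t)) x y))"

section \<open>Fourier growth rates\<close>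

text \<open>The functions to which the Fourier transform is applied: \<open>C\<^sup>2\<close> in space,
  \<open>C\<^sup>1\<close> in time, with the derivatives occurring in the equation integrable in space,
  locally uniformly in time. Being a solution of the system is not required.\<close>

definition decaying0 :: "(real \<Rightarrow> field2) \<Rightarrow> bool" where
  "decaying0 u \<longleftrightarrow>
     continuous_on UNIV (\<lambda>(t, x, y). u t x y) \<and>
     (\<forall>T. \<exists>C. \<forall>t x y. \<bar>t\<bar> \<le> T \<longrightarrow> norm (u t x y) \<le> C / ((1 + x\<^sup>2) * (1 + y\<^sup>2)))"

primrec decaying :: "nat \<Rightarrow> (real \<Rightarrow> field2) \<Rightarrow> bool" where
  "decaying 0 u \<longleftrightarrow> decaying0 u"
| "decaying (Suc n) u \<longleftrightarrow>
     decaying0 u \<and>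
     (\<forall>t x y. (\<lambda>s. u t s y) differentiable (at x) \<and> (\<lambda>s. u t x s) differentiable (at y)) \<and>
     decaying n (\<lambda>t. partial_x (u t)) \<and> decaying n (\<lambda>t. partial_y (u t))"

definition admissible :: "(real \<Rightarrow> field2) \<Rightarrow> bool" where
  "admissible u \<longleftrightarrow>
     decaying 2 u \<and>
     (\<forall>t x y. (\<lambda>s. u s x y) differentiable (at t)) \<and>
     decaying0 (partial_t u)"

text \<open>The Fourier transform of the equation at the frequency \<open>(kx, ky)\<close> is the ordinary
  differential equation with rate \<open>\<nu>\<close> for the Fourier coefficient.\<close>

definition is_growth_rate ::
  "real \<Rightarrow> real \<Rightarrow> real \<Rightarrow> real \<Rightarrow> real \<Rightarrow> real \<Rightarrow> complex \<Rightarrow> bool" where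
  "is_growth_rate ax ay b \<sigma> kx ky \<nu> \<longleftrightarrow>
     (\<forall>u t. admissible u \<longrightarrow>
        (fourier (layer_lhs ax ay b \<sigma> u t) kx ky = 0 \<longleftrightarrow>
         ((\<lambda>s. fourier (u s) kx ky) has_vector_derivative \<nu> * fourier (u t) kx ky) (at t)))"

definition growth_rate ::
  "real \<Rightarrow> real \<Rightarrow> real \<Rightarrow> real \<Rightarrow> real \<Rightarrow> real \<Rightarrow> complex" where
  "growth_rate ax ay b \<sigma> kx ky = (THE \<nu>. is_growth_rate ax ay b \<sigma> kx ky \<nu>)"

section \<open>The stability threshold\<close>

definition beta_tilde :: "real \<Rightarrow> real \<Rightarrow> real \<Rightarrow> real" where
  "beta_tilde ax ay b = \<bar>ax\<bar> powr (- 1 / 2) * \<bar>ay\<bar> powr (- 1 / 2) * b"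

text \<open>Only meant for \<open>0 \<le> b < 1\<close>.\<close>

definition sigma1 :: "real \<Rightarrow> ereal" where
  "sigma1 b =
     (if b = 0 then \<infinity> else ereal (sqrt 2 / (4 * b) * (2 - b + sqrt (b\<^sup>2 + 12 * b + 4))))"

end

theory Submission
  imports Defs "HOL-Probability.Sinc_Integral"
begin

text \<open>The growth rate is \<open>\<i> S\<close>, where \<open>S\<close> is the Fourier symbol of the spatial operator
  (\<open>growth_rate_eq\<close>). That \<open>\<i> S\<close> satisfies the defining property is integration by parts
  in space (\<open>fourier_layer_lhs\<close>) and differentiation under the integral in time
  (\<open>fourier_has_vector_derivative\<close>). It is the only number with this property because there is a
  field with a purely exponential evolution and nonvanishing Fourier coefficient (\<open>test_solution\<close>).

  Stability then is the inequality \<open>Im S \<ge> 0\<close>. Rescaling the frequencies to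
  \<open>X = \<surd>ax kx\<close>, \<open>Y = \<surd>ay ky\<close> turns the mixed coefficient into \<open>B\<close>, the value of
  \<open>beta_tilde\<close>. The rescaled symbol is symmetric under exchange of \<open>X\<close> and \<open>Y\<close>, and with
  \<open>\<tau> = e\<^sup>i\<^sup>\<pi>\<^sup>/\<^sup>4 \<sigma>\<close> it is diagonal in \<open>X \<plusminus> Y\<close> (\<open>layer_symbol_diagonal\<close>):
  \<open>- S = (1 + B/2) (X + Y)\<^sup>2 / 2 ((1 - \<tau> B/2) / (1 + \<tau>))\<^sup>2 +
         (1 - B/2) (X - Y)\<^sup>2 / 2 ((1 + \<tau> B/2) / (1 + \<tau>))\<^sup>2\<close>.
  Ellipticity makes the weights positive, so both squares should have
  nonpositive imaginary part. The quotients \<open>(1 - \<tau> \<beta>) / (1 + \<tau>)\<close> with \<open>\<beta> = \<plusminus> B/2\<close> lie in the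
  lower half-plane, and their squares lie there too if their real parts are nonnegative
  (\<open>Im_mode_le_0\<close>). This is a quadratic inequality in \<open>\<sigma>\<close>, which is strictest at the larger of the
  two values of \<open>\<beta>\<close> and whose positive root is \<open>sigma1 \<bar>B\<bar>\<close>. The condition becomes stricter as
  \<open>\<bar>B\<bar>\<close> grows, so the equation with the largest \<open>\<bar>beta_tilde\<bar>\<close> decides
  (\<open>sigma1_condition\<close>).\<close>

section \<open>Integrals of decaying fields on the plane\<close>

text \<open>The spatial part of the decay condition on the fields. The majorant
  \<open>C / ((1 + x\<^sup>2) (1 + y\<^sup>2))\<close> is integrable on the plane and on every horizontal and vertical line, so
  a single bound justifies the Fourier integral, Fubini's theorem and the vanishing of the boundary
  terms in an integration by parts.\<close>

definition decays :: "field2 \<Rightarrow> bool" where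
  "decays f \<longleftrightarrow> continuous_on UNIV (\<lambda>(x, y). f x y) \<and>
     (\<exists>C. \<forall>x y. norm (f x y) \<le> C / ((1 + x\<^sup>2) * (1 + y\<^sup>2)))"

definition wave :: "real \<Rightarrow> real \<Rightarrow> field2" where
  "wave kx ky x y = exp (- \<i> * complex_of_real (kx * x + ky * y))"

lemma norm_wave [simp]: "norm (wave kx ky x y) = 1"
  by (simp add: wave_def norm_exp_eq_Re)

lemma continuous_on_wave: "continuous_on UNIV (\<lambda>(x, y). wave kx ky x y)"
  unfolding wave_def case_prod_beta by (intro continuous_intros)

lemma one_plus_square_pos: "0 < 1 + (x::real)\<^sup>2"
  by (simp add: add_pos_nonneg)

lemma integrable_inverse_one_plus_square: "integrable lborel (\<lambda>x::real. 1 / (1 + x\<^sup>2))"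
  using integrable_inverse_1_plus_square
  by (simp add: set_integrable_def einterval_def inverse_eq_divide)

lemma integrable_weight:
  "integrable lborel (\<lambda>z::real \<times> real. C / ((1 + (fst z)\<^sup>2) * (1 + (snd z)\<^sup>2)))"
proof -
  let ?w = "\<lambda>x::real. 1 / (1 + x\<^sup>2)"
  have "integrable (lborel \<Otimes>\<^sub>M lborel) (\<lambda>z. ?w (fst z) * ?w (snd z))"
  proof (rule lborel_pair.Fubini_integrable)
    show "(\<lambda>z. ?w (fst z) * ?w (snd z)) \<in> borel_measurable (lborel \<Otimes>\<^sub>M lborel)"
      by measurable
    have "integrable lborel (\<lambda>x::real. ?w x * (\<integral>y. ?w y \<partial>lborel))"
      using integrable_inverse_one_plus_square by (rule integrable_mult_left)
    moreover have "(\<integral>y. norm (?w (fst (x, y)) * ?w (snd (x, y))) \<partial>lborel) =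
        ?w x * (\<integral>y. ?w y \<partial>lborel)" for x :: real
    proof -
      have "(\<integral>y. norm (?w (fst (x, y)) * ?w (snd (x, y))) \<partial>lborel) = (\<integral>y. ?w x * ?w y \<partial>lborel)"
        by (intro Bochner_Integration.integral_cong) (auto simp: abs_mult)
      also have "\<dots> = ?w x * (\<integral>y. ?w y \<partial>lborel)"
        by (rule Bochner_Integration.integral_mult_right) (rule integrable_inverse_one_plus_square)
      finally show ?thesis .
    qed
    ultimately show "integrable lborel (\<lambda>x. \<integral>y. norm (?w (fst (x, y)) * ?w (snd (x, y))) \<partial>lborel)"
      by presburger
    show "AE x in lborel. integrable lborel (\<lambda>y. ?w (fst (x, y)) * ?w (snd (x, y)))"
      using integrable_mult_right[OF integrable_inverse_one_plus_square]
      by (intro AE_I2) (simp only: fst_conv snd_conv)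
  qed
  then have "integrable lborel (\<lambda>z::real \<times> real. C * (?w (fst z) * ?w (snd z)))"
    unfolding lborel_prod by (rule integrable_mult_right)
  then show ?thesis by (simp only: times_divide_times_eq times_divide_eq_right mult_1_right divide_divide_eq_left)
qed

lemma decays_integrable:
  assumes "decays f" shows "integrable lborel (\<lambda>z. f (fst z) (snd z))"
proof -
  obtain C where C: "\<And>x y. norm (f x y) \<le> C / ((1 + x\<^sup>2) * (1 + y\<^sup>2))"
    using assms by (auto simp: decays_def)
  have "continuous_on UNIV (\<lambda>z. f (fst z) (snd z))"
    using assms by (simp add: decays_def case_prod_beta)
  then have m: "(\<lambda>z. f (fst z) (snd z)) \<in> borel_measurable lborel"
    by (simp add: borel_measurable_continuous_onI)
  show ?thesis
    by (rule Bochner_Integration.integrable_bound[OF integrable_weight[of C] m], rule AE_I2,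
        rule order_trans[OF C], unfold real_norm_def, rule abs_ge_self)
qed

lemma decays_lincomb:
  assumes "decays f" "decays g"
  shows "decays (\<lambda>x y. a * f x y + b * g x y)"
proof -
  obtain C where C: "\<And>x y. norm (f x y) \<le> C / ((1 + x\<^sup>2) * (1 + y\<^sup>2))"
    using assms(1) by (auto simp: decays_def)
  obtain D where D: "\<And>x y. norm (g x y) \<le> D / ((1 + x\<^sup>2) * (1 + y\<^sup>2))"
    using assms(2) by (auto simp: decays_def)
  have "norm (a * f x y + b * g x y) \<le> (norm a * C + norm b * D) / ((1 + x\<^sup>2) * (1 + y\<^sup>2))" for x y
  proof -
    have "norm (a * f x y + b * g x y) \<le> norm a * norm (f x y) + norm b * norm (g x y)"
      by (rule order_trans[OF norm_triangle_ineq]) (simp add: norm_mult)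
    also have "\<dots> \<le> norm a * (C / ((1 + x\<^sup>2) * (1 + y\<^sup>2))) + norm b * (D / ((1 + x\<^sup>2) * (1 + y\<^sup>2)))"
      by (intro add_mono mult_left_mono C D) auto
    finally show ?thesis by (simp add: add_divide_distrib)
  qed
  moreover have "continuous_on UNIV (\<lambda>z. a * f (fst z) (snd z) + b * g (fst z) (snd z))"
    using assms unfolding decays_def case_prod_beta
    by (intro continuous_on_add continuous_on_mult_left) (elim conjE, assumption)+
  ultimately show ?thesis
    unfolding decays_def case_prod_beta by (intro conjI exI allI)
qed

lemma decays_wave:
  assumes "decays f" shows "decays (\<lambda>x y. wave kx ky x y * f x y)"
  using assms continuous_on_wave[of kx ky] unfolding decays_def case_prod_beta
  by (simp add: norm_mult continuous_on_mult)

lemma fourier_alt: "fourier f kx ky = (LINT z|lborel. wave kx ky (fst z) (snd z) * f (fst z) (snd z))"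
  by (simp add: fourier_def wave_def)

lemma fourier_lincomb:
  assumes "decays f" "decays g"
  shows "fourier (\<lambda>x y. a * f x y + b * g x y) kx ky = a * fourier f kx ky + b * fourier g kx ky"
proof -
  let ?F = "\<lambda>z. wave kx ky (fst z) (snd z) * f (fst z) (snd z)"
  let ?G = "\<lambda>z. wave kx ky (fst z) (snd z) * g (fst z) (snd z)"
  have F: "integrable lborel ?F" and G: "integrable lborel ?G"
    using decays_integrable[OF decays_wave[OF assms(1), of kx ky]]
      decays_integrable[OF decays_wave[OF assms(2), of kx ky]] by - assumption
  have "fourier (\<lambda>x y. a * f x y + b * g x y) kx ky = (LINT z|lborel. a * ?F z + b * ?G z)"
    unfolding fourier_alt by (rule Bochner_Integration.integral_cong) (simp_all add: algebra_simps)
  also have "\<dots> = (LINT z|lborel. a * ?F z) + (LINT z|lborel. b * ?G z)"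
    using F G by (subst Bochner_Integration.integral_add) simp_all
  also have "\<dots> = a * (LINT z|lborel. ?F z) + b * (LINT z|lborel. ?G z)"
    using F G by (simp only: Bochner_Integration.integral_mult_right)
  finally show ?thesis unfolding fourier_alt .
qed

lemma tendsto_zero_of_quadratic_bound:
  fixes h :: "real \<Rightarrow> complex"
  assumes h: "\<And>x. norm (h x) \<le> C / (1 + x\<^sup>2)"
  shows "(h \<longlongrightarrow> 0) at_top" "(h \<longlongrightarrow> 0) at_bot"
proof -
  have *: "(h \<longlongrightarrow> 0) F" if F: "filterlim (\<lambda>x::real. x\<^sup>2) at_top F" for F
  proof (rule Lim_null_comparison)
    show "\<forall>\<^sub>F x in F. norm (h x) \<le> C * inverse (1 + x\<^sup>2)"
      by (rule always_eventually) (use h in \<open>auto simp only: divide_inverse\<close>)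
    show "((\<lambda>x::real. C * inverse (1 + x\<^sup>2)) \<longlongrightarrow> 0) F"
      by (rule tendsto_mult_right_zero, rule tendsto_inverse_0_at_top,
          rule filterlim_tendsto_add_at_top[OF tendsto_const F])
  qed
  show "(h \<longlongrightarrow> 0) at_top"
    by (rule *, rule filterlim_pow_at_top[OF _ filterlim_ident]) simp
  show "(h \<longlongrightarrow> 0) at_bot"
    by (rule *, rule filterlim_pow_at_bot_even[OF _ filterlim_ident]) simp_all
qed

text \<open>The fundamental theorem of calculus on the whole line: the quadratic bound on \<open>h\<close> kills both
  boundary terms, and the bound on \<open>h'\<close> makes the integral absolutely convergent. Applied to a wave
  times a field on each line, this is the integration by parts behind
  \<open>\<partial>\<^sub>x \<rightarrow> \<i> k\<^sub>x\<close>.\<close>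

lemma integral_derivative_eq_0:
  fixes h h' :: "real \<Rightarrow> complex"
  assumes d: "\<And>x. (h has_vector_derivative h' x) (at x)"
    and c: "continuous_on UNIV h'"
    and h: "\<And>x. norm (h x) \<le> C / (1 + x\<^sup>2)"
    and h': "\<And>x. norm (h' x) \<le> C' / (1 + x\<^sup>2)"
  shows "(LINT x|lborel. h' x) = 0"
proof -
  have "integrable lborel (\<lambda>x::real. C' * (1 / (1 + x\<^sup>2)))"
    using integrable_inverse_one_plus_square by (rule integrable_mult_right)
  moreover have "h' \<in> borel_measurable lborel"
    using c by (simp add: borel_measurable_continuous_onI)
  moreover have "AE x in lborel. norm (h' x) \<le> norm (C' * (1 / (1 + x\<^sup>2)))"
    by (rule AE_I2, rule order_trans[OF h'], simp only: mult_1_right times_divide_eq_right real_norm_def abs_ge_self)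
  ultimately have "integrable lborel h'"
    by (rule Bochner_Integration.integrable_bound)
  then have i: "set_integrable lborel (einterval (-\<infinity>) \<infinity>) h'"
    by (simp add: set_integrable_def einterval_def)
  have isc: "isCont h' x" for x
    using c by (simp add: continuous_on_eq_continuous_at)
  have "((h \<circ> real_of_ereal) \<longlongrightarrow> 0) (at_right (-\<infinity>))" "((h \<circ> real_of_ereal) \<longlongrightarrow> 0) (at_left \<infinity>)"
    using tendsto_zero_of_quadratic_bound[OF h] by (simp_all add: ereal_tendsto_simps)
  then have "(LBINT x=-\<infinity>..\<infinity>. h' x) = 0 - 0"
    by (intro interval_integral_FTC_integrable[where F = h] d isc i) simp_all
  then show ?thesis
    by (simp add: interval_lebesgue_integral_def set_lebesgue_integral_def einterval_def)
qed

lemma decays_slices: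
  assumes "decays f"
  shows "continuous_on UNIV (\<lambda>x. f x y)" "\<exists>C. \<forall>x. norm (f x y) \<le> C / (1 + x\<^sup>2)"
    and "continuous_on UNIV (\<lambda>y. f x y)" "\<exists>C. \<forall>y. norm (f x y) \<le> C / (1 + y\<^sup>2)"
proof -
  have c: "continuous_on UNIV (\<lambda>z. f (fst z) (snd z))"
    using assms by (simp add: decays_def case_prod_beta)
  show "continuous_on UNIV (\<lambda>x. f x y)"
    using continuous_on_compose2[OF c, of UNIV "\<lambda>x. (x, y)"] by (simp add: continuous_intros)
  show "continuous_on UNIV (\<lambda>y. f x y)"
    using continuous_on_compose2[OF c, of UNIV "\<lambda>y. (x, y)"] by (simp add: continuous_intros)
  obtain C where C: "\<And>x y. norm (f x y) \<le> C / ((1 + x\<^sup>2) * (1 + y\<^sup>2))"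
    using assms by (auto simp: decays_def)
  show "\<exists>C. \<forall>x. norm (f x y) \<le> C / (1 + x\<^sup>2)"
    by (rule exI[of _ "C / (1 + y\<^sup>2)"]) (use C in \<open>simp add: mult.commute\<close>)
  show "\<exists>C. \<forall>y. norm (f x y) \<le> C / (1 + y\<^sup>2)"
    by (rule exI[of _ "C / (1 + x\<^sup>2)"]) (use C in simp)
qed

lemma integral_derivative_x_eq_0:
  assumes "decays g" "decays g'"
    and d: "\<And>x y. ((\<lambda>s. g s y) has_vector_derivative g' x y) (at x)"
  shows "(LINT z|lborel. g' (fst z) (snd z)) = 0"
proof -
  have "(LINT x|lborel. g' x y) = 0" for y
    using integral_derivative_eq_0[OF d] decays_slices[OF assms(1)] decays_slices[OF assms(2)]
    by metis
  moreover have "integrable (lborel \<Otimes>\<^sub>M lborel) (case_prod g')"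
    using decays_integrable[OF assms(2)] by (simp add: lborel_prod case_prod_beta')
  ultimately show ?thesis
    using lborel_pair.integral_snd[of g'] by (simp add: lborel_prod case_prod_beta')
qed

lemma integral_derivative_y_eq_0:
  assumes "decays g" "decays g'"
    and d: "\<And>x y. ((\<lambda>s. g x s) has_vector_derivative g' x y) (at y)"
  shows "(LINT z|lborel. g' (fst z) (snd z)) = 0"
proof -
  have "(LINT y|lborel. g' x y) = 0" for x
    using integral_derivative_eq_0[OF d] decays_slices[OF assms(1)] decays_slices[OF assms(2)]
    by metis
  moreover have "integrable (lborel \<Otimes>\<^sub>M lborel) (\<lambda>z. g' (fst z) (snd z))"
    using decays_integrable[OF assms(2)] by (simp add: lborel_prod)
  ultimately show ?thesis
    using lborel_pair.integral_fst'[of "\<lambda>z. g' (fst z) (snd z)"] by (simp add: lborel_prod)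
qed

lemma exp_affine_has_vector_derivative:
  "((\<lambda>s. exp (c + d * complex_of_real s)) has_vector_derivative
      d * exp (c + d * complex_of_real s)) (at s)"
  by (rule has_vector_derivative_real_field) (auto intro!: derivative_eq_intros)

lemma wave_has_vector_derivative:
  "((\<lambda>s. wave kx ky s y) has_vector_derivative - \<i> * kx * wave kx ky x y) (at x)"
  "((\<lambda>s. wave kx ky x s) has_vector_derivative - \<i> * ky * wave kx ky x y) (at y)"
  using exp_affine_has_vector_derivative[of "- \<i> * ky * y" "- \<i> * kx" x]
    exp_affine_has_vector_derivative[of "- \<i> * kx * x" "- \<i> * ky" y]
  by (simp_all add: wave_def algebra_simps)

section \<open>Fourier transforms of the layer operators\<close>

text \<open>The integrand of \<open>fourier (\<partial>\<^sub>x f - \<i> k\<^sub>x f)\<close> is the \<open>x\<close>-derivative of the wave times \<open>f\<close>,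
  so its integral vanishes.\<close>

lemma fourier_partial_x:
  assumes f: "decays f" "decays (partial_x f)" "\<And>x y. (\<lambda>s. f s y) differentiable (at x)"
  shows "fourier (partial_x f) kx ky = \<i> * kx * fourier f kx ky"
proof -
  let ?r = "\<lambda>x y. 1 * partial_x f x y + (- \<i> * kx) * f x y"
  have "((\<lambda>s. wave kx ky s y * f s y) has_vector_derivative wave kx ky x y * ?r x y) (at x)" for x y
  proof -
    have "((\<lambda>s. f s y) has_vector_derivative partial_x f x y) (at x)"
      using f(3) by (simp add: partial_x_def vector_derivative_works)
    from has_vector_derivative_mult[OF wave_has_vector_derivative(1) this]
    show ?thesis by (simp add: algebra_simps)
  qed
  then have "(LINT z|lborel. wave kx ky (fst z) (snd z) * ?r (fst z) (snd z)) = 0"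
    by (rule integral_derivative_x_eq_0[OF decays_wave[OF f(1)] decays_wave[OF decays_lincomb[OF f(2,1)]]])
  then have "fourier ?r kx ky = 0" unfolding fourier_alt .
  then show ?thesis unfolding fourier_lincomb[OF f(2,1)] by simp
qed

lemma fourier_partial_y:
  assumes f: "decays f" "decays (partial_y f)" "\<And>x y. (\<lambda>s. f x s) differentiable (at y)"
  shows "fourier (partial_y f) kx ky = \<i> * ky * fourier f kx ky"
proof -
  let ?r = "\<lambda>x y. 1 * partial_y f x y + (- \<i> * ky) * f x y"
  have "((\<lambda>s. wave kx ky x s * f x s) has_vector_derivative wave kx ky x y * ?r x y) (at y)" for x y
  proof -
    have "((\<lambda>s. f x s) has_vector_derivative partial_y f x y) (at y)"
      using f(3) by (simp add: partial_y_def vector_derivative_works)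
    from has_vector_derivative_mult[OF wave_has_vector_derivative(2) this]
    show ?thesis by (simp add: algebra_simps)
  qed
  then have "(LINT z|lborel. wave kx ky (fst z) (snd z) * ?r (fst z) (snd z)) = 0"
    by (rule integral_derivative_y_eq_0[OF decays_wave[OF f(1)] decays_wave[OF decays_lincomb[OF f(2,1)]]])
  then have "fourier ?r kx ky = 0" unfolding fourier_alt .
  then show ?thesis unfolding fourier_lincomb[OF f(2,1)] by simp
qed

text \<open>The fields on which one first-order operator is transformed into multiplication by its
  symbol. The class is a complex vector space, and so an operator \<open>layer_Dx\<close> or \<open>layer_Dy\<close>
  maps a field with regular partial derivatives to a regular field. This is what allows the operators
  to be applied twice.\<close>

definition regular :: "field2 \<Rightarrow> bool" where
  "regular f \<longleftrightarrow> decays f \<and> decays (partial_x f) \<and> decays (partial_y f) \<and>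
     (\<forall>x y. (\<lambda>s. f s y) differentiable (at x) \<and> (\<lambda>s. f x s) differentiable (at y))"

lemma regularD:
  assumes "regular f"
  shows "decays f" "decays (partial_x f)" "decays (partial_y f)"
    and "((\<lambda>s. f s y) has_vector_derivative partial_x f x y) (at x)"
    and "((\<lambda>s. f x s) has_vector_derivative partial_y f x y) (at y)"
  using assms by (simp_all add: regular_def partial_x_def partial_y_def vector_derivative_works)

lemma regular_lincomb:
  assumes "regular f" "regular g"
  shows "regular (\<lambda>x y. a * f x y + b * g x y)"
proof -
  let ?h = "\<lambda>x y. a * f x y + b * g x y"
  have dx: "((\<lambda>s. ?h s y) has_vector_derivative a * partial_x f x y + b * partial_x g x y) (at x)"
    and dy: "((\<lambda>s. ?h x s) has_vector_derivative a * partial_y f x y + b * partial_y g x y) (at y)" for x y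
    by (intro has_vector_derivative_add has_vector_derivative_mult_right regularD assms)+
  have "partial_x ?h = (\<lambda>x y. a * partial_x f x y + b * partial_x g x y)"
    unfolding partial_x_def[of ?h] by (intro ext vector_derivative_at dx)
  moreover have "partial_y ?h = (\<lambda>x y. a * partial_y f x y + b * partial_y g x y)"
    unfolding partial_y_def[of ?h] by (intro ext vector_derivative_at dy)
  moreover have "\<forall>x y. (\<lambda>s. ?h s y) differentiable (at x) \<and> (\<lambda>s. ?h x s) differentiable (at y)"
    using dx dy by (intro allI conjI differentiableI_vector)
  moreover have "decays ?h" "decays (\<lambda>x y. a * partial_x f x y + b * partial_x g x y)"
    "decays (\<lambda>x y. a * partial_y f x y + b * partial_y g x y)"
    by (intro decays_lincomb regularD assms)+
  ultimately show ?thesis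
    unfolding regular_def by presburger
qed

lemma fourier_first_order:
  assumes "regular f"
  shows "fourier (\<lambda>x y. a * partial_x f x y + b * partial_y f x y) kx ky =
    (a * (\<i> * kx) + b * (\<i> * ky)) * fourier f kx ky"
proof -
  note f = regularD[OF assms]
  have "fourier (\<lambda>x y. a * partial_x f x y + b * partial_y f x y) kx ky =
      a * (\<i> * kx * fourier f kx ky) + b * (\<i> * ky * fourier f kx ky)"
    unfolding fourier_lincomb[OF f(2,3)] fourier_partial_x[OF f(1,2) differentiableI_vector[OF f(4)]]
      fourier_partial_y[OF f(1,3) differentiableI_vector[OF f(5)]] ..
  then show ?thesis by (simp add: algebra_simps)
qed

definition prefactor :: "real \<Rightarrow> complex" where
  "prefactor \<sigma> = 1 / (1 + exp (\<i> * pi / 4) * complex_of_real \<sigma>)"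

definition skew :: "real \<Rightarrow> real \<Rightarrow> real \<Rightarrow> complex" where
  "skew a b \<sigma> = exp (\<i> * pi / 4) * complex_of_real (b / (2 * a)) * complex_of_real \<sigma>"

definition symbol_x :: "real \<Rightarrow> real \<Rightarrow> real \<Rightarrow> real \<Rightarrow> real \<Rightarrow> complex" where
  "symbol_x ax b \<sigma> kx ky = prefactor \<sigma> * (\<i> * kx - skew ax b \<sigma> * (\<i> * ky))"

definition symbol_y :: "real \<Rightarrow> real \<Rightarrow> real \<Rightarrow> real \<Rightarrow> real \<Rightarrow> complex" where
  "symbol_y ay b \<sigma> kx ky = prefactor \<sigma> * (\<i> * ky - skew ay b \<sigma> * (\<i> * kx))"

definition layer_symbol :: "real \<Rightarrow> real \<Rightarrow> real \<Rightarrow> real \<Rightarrow> real \<Rightarrow> real \<Rightarrow> complex" where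
  "layer_symbol ax ay b \<sigma> kx ky =
     ax * (symbol_x ax b \<sigma> kx ky)\<^sup>2 + ay * (symbol_y ay b \<sigma> kx ky)\<^sup>2
     + b * symbol_x ax b \<sigma> kx ky * symbol_y ay b \<sigma> kx ky"

lemma layer_Dx_lincomb: "layer_Dx ax b \<sigma> f =
    (\<lambda>x y. prefactor \<sigma> * partial_x f x y + (- prefactor \<sigma> * skew ax b \<sigma>) * partial_y f x y)"
  unfolding layer_Dx_def prefactor_def[symmetric] skew_def[symmetric] by (simp add: algebra_simps)

lemma layer_Dy_lincomb: "layer_Dy ay b \<sigma> f =
    (\<lambda>x y. (- prefactor \<sigma> * skew ay b \<sigma>) * partial_x f x y + prefactor \<sigma> * partial_y f x y)"
  unfolding layer_Dy_def prefactor_def[symmetric] skew_def[symmetric] by (simp add: algebra_simps)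

lemma fourier_layer_Dx:
  "regular f \<Longrightarrow> fourier (layer_Dx ax b \<sigma> f) kx ky = symbol_x ax b \<sigma> kx ky * fourier f kx ky"
  unfolding layer_Dx_lincomb symbol_x_def fourier_first_order by (simp add: algebra_simps)

lemma fourier_layer_Dy:
  "regular f \<Longrightarrow> fourier (layer_Dy ay b \<sigma> f) kx ky = symbol_y ay b \<sigma> kx ky * fourier f kx ky"
  unfolding layer_Dy_lincomb symbol_y_def fourier_first_order by (simp add: algebra_simps)

lemma decays_layer_D:
  assumes "regular f"
  shows "decays (layer_Dx ax b \<sigma> f)" "decays (layer_Dy ay b \<sigma> f)"
  unfolding layer_Dx_lincomb layer_Dy_lincomb by (intro decays_lincomb regularD assms)+

lemma regular_layer_D:
  assumes "regular (partial_x f)" "regular (partial_y f)"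
  shows "regular (layer_Dx ax b \<sigma> f)" "regular (layer_Dy ay b \<sigma> f)"
  unfolding layer_Dx_lincomb layer_Dy_lincomb by (intro regular_lincomb assms)+

lemma decaying0_imp_decays:
  assumes "decaying0 u" shows "decays (u t)"
proof -
  have c: "continuous_on UNIV (\<lambda>p. u (fst p) (fst (snd p)) (snd (snd p)))"
    using assms by (simp add: decaying0_def case_prod_beta)
  have "continuous_on UNIV (\<lambda>z. (t, z))"
    by (intro continuous_on_Pair continuous_on_const continuous_on_id)
  from continuous_on_compose2[OF c this]
  have "continuous_on UNIV (\<lambda>(x, y). u t x y)"
    by (simp add: case_prod_beta)
  moreover obtain C where "\<And>s x y. \<bar>s\<bar> \<le> \<bar>t\<bar> \<Longrightarrow> norm (u s x y) \<le> C / ((1 + x\<^sup>2) * (1 + y\<^sup>2))"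
    using assms unfolding decaying0_def by meson
  ultimately show ?thesis unfolding decays_def by blast
qed

lemma decaying_imp_decaying0: "decaying n u \<Longrightarrow> decaying0 u"
  by (cases n) simp_all

lemma decaying_imp_regular: "decaying (Suc n) u \<Longrightarrow> regular (u t)"
  using decaying_imp_decaying0[of n "\<lambda>t. partial_x (u t)"] decaying_imp_decaying0[of n "\<lambda>t. partial_y (u t)"]
    decaying0_imp_decays[of "\<lambda>t. partial_x (u t)"] decaying0_imp_decays[of "\<lambda>t. partial_y (u t)"]
    decaying0_imp_decays[of u]
  by (simp add: regular_def)

lemma admissible_regular:
  assumes "admissible u"
  shows "regular (u t)" "regular (partial_x (u t))" "regular (partial_y (u t))"
  using assms decaying_imp_regular[of 1 u] decaying_imp_regular[of 0 "\<lambda>t. partial_x (u t)"]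
    decaying_imp_regular[of 0 "\<lambda>t. partial_y (u t)"]
  by (simp_all add: admissible_def numeral_2_eq_2)

text \<open>Each of the three second-order terms is a first-order operator applied to a regular field, so
  its transform is obtained by two applications of the first-order rule.\<close>

lemma fourier_layer_lhs:
  assumes "admissible u"
  shows "fourier (layer_lhs ax ay b \<sigma> u t) kx ky =
    \<i> * fourier (partial_t u t) kx ky + layer_symbol ax ay b \<sigma> kx ky * fourier (u t) kx ky"
proof -
  note r = admissible_regular[OF assms, of t]
  note rD = regular_layer_D[OF r(2,3)]
  let ?xx = "layer_Dx ax b \<sigma> (layer_Dx ax b \<sigma> (u t))"
  let ?yy = "layer_Dy ay b \<sigma> (layer_Dy ay b \<sigma> (u t))"
  let ?xy = "layer_Dx ax b \<sigma> (layer_Dy ay b \<sigma> (u t))"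
  have d: "decays ?xx" "decays ?yy" "decays ?xy"
    by (rule decays_layer_D rD)+
  have dt: "decays (partial_t u t)"
    using assms by (simp add: admissible_def decaying0_imp_decays)
  \<comment> \<open>Factors 1 bring the nested sums into the shape of \<open>fourier_lincomb\<close>.\<close>
  have d1: "decays (\<lambda>x y. ax * ?xx x y + ay * ?yy x y)" by (rule decays_lincomb[OF d(1,2)])
  have d2: "decays (\<lambda>x y. 1 * (ax * ?xx x y + ay * ?yy x y) + b * ?xy x y)"
    by (rule decays_lincomb[OF d1 d(3)])
  have eq: "layer_lhs ax ay b \<sigma> u t = (\<lambda>x y. \<i> * partial_t u t x y +
     1 * (1 * (ax * ?xx x y + ay * ?yy x y) + b * ?xy x y))"
    by (simp add: layer_lhs_def)
  have "fourier (layer_lhs ax ay b \<sigma> u t) kx ky = \<i> * fourier (partial_t u t) kx ky +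
     (ax * fourier ?xx kx ky + ay * fourier ?yy kx ky + b * fourier ?xy kx ky)"
    unfolding eq fourier_lincomb[OF dt d2] fourier_lincomb[OF d1 d(3)] fourier_lincomb[OF d(1,2)]
    by simp
  then show ?thesis
    unfolding fourier_layer_Dx[OF rD(1)] fourier_layer_Dx[OF rD(2)] fourier_layer_Dy[OF rD(2)]
      fourier_layer_Dx[OF r(1)] fourier_layer_Dy[OF r(1)] layer_symbol_def
    by (simp add: algebra_simps power2_eq_square)
qed

section \<open>Time derivative of a Fourier coefficient\<close>

text \<open>Differentiation under the integral sign. The normalized remainder \<open>R s\<close> of the first-order
  expansion of \<open>u\<close> at \<open>t\<close> tends to 0 pointwise. By the mean value inequality it is at most
  twice the bound that \<open>\<partial>\<^sub>t u\<close> satisfies locally uniformly in time, so dominated convergence applies.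
  The transform of \<open>R s\<close> is the remainder of the Fourier coefficient.\<close>

lemma fourier_has_vector_derivative:
  assumes "admissible u"
  shows "((\<lambda>s. fourier (u s) kx ky) has_vector_derivative fourier (partial_t u t) kx ky) (at t)"
proof -
  have u: "decays (u s)" and ut: "decays (partial_t u s)" for s
    using assms regularD(1)[OF admissible_regular(1)[OF assms]]
    by (simp_all add: admissible_def decaying0_imp_decays)
  have d: "((\<lambda>s. u s x y) has_vector_derivative partial_t u s x y) (at s)" for s x y
    using assms by (simp add: admissible_def partial_t_def vector_derivative_works)
  obtain C where C: "\<And>s x y. \<bar>s\<bar> \<le> \<bar>t\<bar> + 1 \<Longrightarrow>
      norm (partial_t u s x y) \<le> C / ((1 + x\<^sup>2) * (1 + y\<^sup>2))"
    using assms unfolding admissible_def decaying0_def by meson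
  \<comment> \<open>A linear combination of decaying fields, written in the shape of \<open>decays_lincomb\<close>.\<close>
  define R where "R s x y = 1 * (of_real (1 / norm (s - t)) * u s x y + (- of_real (1 / norm (s - t))) * u t x y)
    + (- of_real ((s - t) / norm (s - t))) * partial_t u t x y" for s x y
  have R_alt: "R s x y = (1 / norm (s - t)) *\<^sub>R (u s x y - (u t x y + (s - t) *\<^sub>R partial_t u t x y))" for s x y
    by (simp add: R_def scaleR_conv_of_real algebra_simps diff_divide_distrib add_divide_distrib)
  have R: "decays (R s)" for s
    unfolding R_def by (intro decays_lincomb u ut)
  have fR: "fourier (R s) kx ky = (1 / norm (s - t)) *\<^sub>R (fourier (u s) kx ky -
      (fourier (u t) kx ky + (s - t) *\<^sub>R fourier (partial_t u t) kx ky))" for s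
    unfolding R_def fourier_lincomb[OF decays_lincomb[OF u u] ut] fourier_lincomb[OF u u]
    by (simp add: scaleR_conv_of_real algebra_simps diff_divide_distrib add_divide_distrib)
  have bound: "norm (R s x y) \<le> (2 * C) / ((1 + x\<^sup>2) * (1 + y\<^sup>2))" if s: "\<bar>s - t\<bar> \<le> 1" "s \<noteq> t" for s x y
  proof -
    let ?w = "(1 + x\<^sup>2) * (1 + y\<^sup>2)"
    have "norm (u s x y - u t x y - (s - t) *\<^sub>R partial_t u t x y) \<le> norm (s - t) * (C / ?w + C / ?w)"
    proof (rule vector_differentiable_bound_linearization[where S = "{t - 1..t + 1}"
        and f' = "\<lambda>r. partial_t u r x y"])
      fix r assume r: "r \<in> {t - 1..t + 1}"
      show "((\<lambda>s. u s x y) has_vector_derivative partial_t u r x y) (at r within {t - 1..t + 1})"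
        using d by (rule has_vector_derivative_at_within)
      have "\<bar>r\<bar> \<le> \<bar>t\<bar> + 1" using r by auto
      then show "norm (partial_t u r x y - partial_t u t x y) \<le> C / ?w + C / ?w"
        by (intro order_trans[OF norm_triangle_ineq4] add_mono C) simp_all
    next
      show "closed_segment t s \<subseteq> {t - 1..t + 1}"
        using s by (auto simp: closed_segment_eq_real_ivl)
    qed simp
    then have "norm (R s x y) \<le> (1 / norm (s - t)) * (norm (s - t) * (C / ?w + C / ?w))"
      unfolding R_alt norm_scaleR
      by (intro mult_mono) (simp_all add: diff_diff_eq)
    also have "\<dots> = (2 * C) / ?w" using s by simp
    finally show ?thesis .
  qed
  have "((\<lambda>s. fourier (R s) kx ky) \<longlongrightarrow> 0) (at t)"
    unfolding tendsto_at_iff_sequentially comp_def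
  proof (intro allI impI)
    fix X :: "nat \<Rightarrow> real"
    assume X: "\<forall>i. X i \<in> UNIV - {t}" and lim: "X \<longlonglongrightarrow> t"
    \<comment> \<open>The dominating bound only holds for times within distance 1 of \<open>t\<close>, so the sequence is shifted.\<close>
    obtain N where N: "\<And>n. n \<ge> N \<Longrightarrow> dist (X n) t < 1"
      using lim unfolding lim_sequentially by (meson zero_less_one)
    have lim': "filterlim (\<lambda>n. X (n + N)) (at t) sequentially"
      using LIMSEQ_ignore_initial_segment[OF lim, of N] X by (auto simp: filterlim_at)
    have "(\<lambda>n. LINT z|lborel. wave kx ky (fst z) (snd z) * R (X (n + N)) (fst z) (snd z)) \<longlonglongrightarrow>
          (LINT z|(lborel :: (real \<times> real) measure). 0)"
    proof (rule integral_dominated_convergence[where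
          w = "\<lambda>z. (2 * C) / ((1 + (fst z)\<^sup>2) * (1 + (snd z)\<^sup>2))"])
      show "integrable lborel (\<lambda>z::real \<times> real. (2 * C) / ((1 + (fst z)\<^sup>2) * (1 + (snd z)\<^sup>2)))"
        by (rule integrable_weight)
      show "(\<lambda>z. wave kx ky (fst z) (snd z) * R (X (n + N)) (fst z) (snd z)) \<in> borel_measurable lborel" for n
        by (rule borel_measurable_integrable[OF decays_integrable[OF decays_wave[OF R]]])
      show "AE z in lborel. norm (wave kx ky (fst z) (snd z) * R (X (n + N)) (fst z) (snd z))
          \<le> (2 * C) / ((1 + (fst z)\<^sup>2) * (1 + (snd z)\<^sup>2))" for n
      proof (rule AE_I2)
        fix z :: "real \<times> real"
        have "\<bar>X (n + N) - t\<bar> \<le> 1" "X (n + N) \<noteq> t"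
          using N[of "n + N"] X by (auto simp: dist_real_def)
        from bound[OF this]
        show "norm (wave kx ky (fst z) (snd z) * R (X (n + N)) (fst z) (snd z))
          \<le> (2 * C) / ((1 + (fst z)\<^sup>2) * (1 + (snd z)\<^sup>2))"
          by (simp only: norm_mult norm_wave mult_1_left)
      qed
      show "AE z in lborel. (\<lambda>n. wave kx ky (fst z) (snd z) * R (X (n + N)) (fst z) (snd z)) \<longlonglongrightarrow> 0"
      proof (rule AE_I2)
        fix z :: "real \<times> real"
        have "((\<lambda>s. R s (fst z) (snd z)) \<longlongrightarrow> 0) (at t)"
          using d[where s = t and x = "fst z" and y = "snd z"] unfolding has_vector_derivative_def has_derivative_within R_alt by (rule conjunct2)
        from filterlim_compose[OF this lim']
        show "(\<lambda>n. wave kx ky (fst z) (snd z) * R (X (n + N)) (fst z) (snd z)) \<longlonglongrightarrow> 0"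
          by (rule tendsto_mult_right_zero)
      qed
    qed simp
    then have "(\<lambda>n. fourier (R (X (n + N))) kx ky) \<longlonglongrightarrow> 0"
      by (simp add: fourier_alt)
    then show "(\<lambda>n. fourier (R (X n)) kx ky) \<longlonglongrightarrow> 0"
      by (rule LIMSEQ_offset)
  qed
  then show ?thesis
    unfolding has_vector_derivative_def has_derivative_within fR
    by (simp add: bounded_linear_scaleR_left)
qed

section \<open>Test solutions\<close>

lemma decaying0_tensor:
  assumes c: "continuous_on UNIV c" and p: "continuous_on UNIV p" and q: "continuous_on UNIV q"
    and P: "\<And>x. norm (p x) \<le> P / (1 + x\<^sup>2)" and Q: "\<And>y. norm (q y) \<le> Q / (1 + y\<^sup>2)"
  shows "decaying0 (\<lambda>t x y. c t * (p x * q y))"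
proof -
  have "continuous_on UNIV (\<lambda>z. c (fst z) * (p (fst (snd z)) * q (snd (snd z))))"
    by (intro continuous_on_mult continuous_on_compose2[OF c] continuous_on_compose2[OF p]
        continuous_on_compose2[OF q] continuous_on_fst continuous_on_snd continuous_on_id) simp_all
  moreover have "\<exists>C. \<forall>t x y. \<bar>t\<bar> \<le> T \<longrightarrow> norm (c t * (p x * q y)) \<le> C / ((1 + x\<^sup>2) * (1 + y\<^sup>2))" for T
  proof -
    have "compact (c ` {-T..T})"
      by (intro compact_continuous_image continuous_on_subset[OF c]) auto
    then obtain B where B: "\<And>t. t \<in> {-T..T} \<Longrightarrow> norm (c t) \<le> B"
      using compact_imp_bounded by (meson bounded_iff imageI)
    have "norm (c t * (p x * q y)) \<le> (B * (P * Q)) / ((1 + x\<^sup>2) * (1 + y\<^sup>2))" if "\<bar>t\<bar> \<le> T" for t x y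
    proof -
      have t: "norm (c t) \<le> B" using B that by (auto simp: abs_le_iff)
      have "norm (c t * (p x * q y)) \<le> B * (P / (1 + x\<^sup>2) * (Q / (1 + y\<^sup>2)))"
        unfolding norm_mult
        by (intro mult_mono t P Q mult_nonneg_nonneg norm_ge_zero order_trans[OF norm_ge_zero P]
            order_trans[OF norm_ge_zero t])
      then show ?thesis by simp
    qed
    then show ?thesis by blast
  qed
  ultimately show ?thesis
    unfolding decaying0_def case_prod_beta by blast
qed

text \<open>A plane wave with a positive envelope. The wave cancels the oscillating factor of the Fourier
  integral at the same frequency, so that a positive integral remains, and the envelope has
  derivatives of all orders of the required decay.\<close>

definition profile :: "real \<Rightarrow> real \<Rightarrow> complex" where
  "profile k x = exp (\<i> * k * x) * of_real (1 / (1 + x\<^sup>2))"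

text \<open>With the envelope \<open>h x = 1 / (1 + x\<^sup>2)\<close>, the bounds follow from \<open>\<bar>h'\<bar> \<le> h\<close> and
  \<open>\<bar>h''\<bar> \<le> 6 h\<close>.\<close>

lemma profile_derivatives:
  obtains p' p'' C where
    "\<And>x. (profile k has_vector_derivative p' x) (at x)"
    "\<And>x. (p' has_vector_derivative p'' x) (at x)"
    "continuous_on UNIV p''"
    "\<And>x. norm (profile k x) \<le> C / (1 + x\<^sup>2)"
    "\<And>x. norm (p' x) \<le> C / (1 + x\<^sup>2)"
    "\<And>x. norm (p'' x) \<le> C / (1 + x\<^sup>2)"
proof -
  define h h' h'' where "h x = 1 / (1 + x\<^sup>2)" and "h' x = - 2 * x / (1 + x\<^sup>2)\<^sup>2"
    and "h'' x = (6 * x\<^sup>2 - 2) / (1 + x\<^sup>2) ^ 3" for x :: real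
  define e where "e x = exp (\<i> * k * complex_of_real x)" for x
  define p' where "p' x = e x * (\<i> * k * of_real (h x) + of_real (h' x))" for x
  define p'' where "p'' x = e x * (- (of_real k)\<^sup>2 * of_real (h x) + 2 * \<i> * k * of_real (h' x) + of_real (h'' x))" for x
  have pos: "1 + x\<^sup>2 > 0" "1 + x\<^sup>2 \<noteq> 0" for x :: real
    using one_plus_square_pos[of x] by auto
  have e: "(e has_vector_derivative \<i> * k * e x) (at x)" for x
    using exp_affine_has_vector_derivative[of 0 "\<i> * k" x] unfolding e_def by simp
  have h: "(h has_real_derivative h' x) (at x)" for x
    unfolding h_def h'_def using pos[of x]
    by (auto intro!: derivative_eq_intros simp: power2_eq_square)
  have h2: "(h' has_real_derivative h'' x) (at x)" for x
    unfolding h'_def h''_def using pos[of x]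
    by (auto intro!: derivative_eq_intros simp: divide_simps) (simp add: algebra_simps power_numeral_reduce)
  have p: "profile k = (\<lambda>x. e x * of_real (h x))"
    by (rule ext) (simp add: profile_def e_def h_def)
  have d1: "(profile k has_vector_derivative p' x) (at x)" for x
    using has_vector_derivative_mult[OF e has_vector_derivative_of_real[OF h]]
    unfolding p'_def p by (simp add: algebra_simps)
  have d2: "(p' has_vector_derivative p'' x) (at x)" for x
    using has_vector_derivative_mult[OF e has_vector_derivative_add[OF
        has_vector_derivative_mult_right[OF has_vector_derivative_of_real[OF h], of "\<i> * k"]
        has_vector_derivative_of_real[OF h2]]]
    unfolding p'_def p''_def by (simp add: algebra_simps power2_eq_square)
  have ne: "norm (e x) = 1" for x by (simp add: e_def norm_exp_eq_Re)
  have b0: "\<bar>h x\<bar> = h x" and hp: "h x \<ge> 0" for x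
    using pos[of x] by (auto simp: h_def)
  have b1: "\<bar>h' x\<bar> \<le> h x" for x
  proof -
    have "0 \<le> (\<bar>x\<bar> - 1)\<^sup>2" by simp
    then have "\<bar>2 * x\<bar> \<le> 1 + x\<^sup>2" by (simp add: power2_eq_square algebra_simps abs_mult)
    then have "\<bar>2 * x\<bar> / (1 + x\<^sup>2)\<^sup>2 \<le> (1 + x\<^sup>2) / (1 + x\<^sup>2)\<^sup>2"
      by (rule divide_right_mono) simp
    then show ?thesis using pos[of x] by (simp add: h'_def h_def power2_eq_square abs_mult)
  qed
  have b2: "\<bar>h'' x\<bar> \<le> 6 * h x" for x
  proof -
    have "\<bar>6 * x\<^sup>2 - 2\<bar> \<le> 6 * (1 + x\<^sup>2) * 1" by (simp add: abs_le_iff)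
    also have "\<dots> \<le> 6 * (1 + x\<^sup>2) * (1 + x\<^sup>2)" by (intro mult_left_mono) simp_all
    finally have "\<bar>6 * x\<^sup>2 - 2\<bar> / (1 + x\<^sup>2) ^ 3 \<le> (6 * (1 + x\<^sup>2) * (1 + x\<^sup>2)) / (1 + x\<^sup>2) ^ 3"
      by (rule divide_right_mono) simp
    moreover have w: "6 * w * w / w ^ 3 = 6 * (1 / w)" if "w \<noteq> 0" for w :: real
      using that by (simp add: power3_eq_cube)
    moreover have "\<bar>h'' x\<bar> = \<bar>6 * x\<^sup>2 - 2\<bar> / (1 + x\<^sup>2) ^ 3"
      using pos(1)[of x] by (simp add: h''_def abs_divide)
    ultimately show ?thesis by (simp only: h_def w[OF pos(2)[of x]])
  qed
  let ?C = "k\<^sup>2 + 2 * \<bar>k\<bar> + 6"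
  have c: "continuous_on UNIV p''"
    unfolding p''_def e_def h_def h'_def h''_def using pos(2)
    by (intro continuous_intros) auto
  have B0: "norm (profile k x) \<le> ?C / (1 + x\<^sup>2)" for x
  proof -
    have "norm (profile k x) = 1 * h x" by (simp add: p norm_mult ne b0)
    also have "\<dots> \<le> ?C * h x" by (rule mult_right_mono[OF _ hp]) simp
    finally show ?thesis by (simp add: h_def)
  qed
  have B1: "norm (p' x) \<le> ?C / (1 + x\<^sup>2)" for x
  proof -
    have "norm (p' x) \<le> norm (\<i> * k * of_real (h x)) + norm (complex_of_real (h' x))"
      unfolding p'_def norm_mult[of "e x"] ne mult_1_left by (rule norm_triangle_ineq)
    also have "\<dots> \<le> \<bar>k\<bar> * h x + h x" using b1[of x] by (simp add: norm_mult b0)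
    also have "\<dots> = (\<bar>k\<bar> + 1) * h x" by (simp add: algebra_simps)
    also have "\<dots> \<le> ?C * h x" by (rule mult_right_mono[OF _ hp]) simp
    finally show ?thesis by (simp add: h_def)
  qed
  have B2: "norm (p'' x) \<le> ?C / (1 + x\<^sup>2)" for x
  proof -
    have "norm (p'' x) \<le> norm (- (of_real k)\<^sup>2 * complex_of_real (h x)) + norm (2 * \<i> * k * of_real (h' x))
        + norm (complex_of_real (h'' x))"
      unfolding p''_def norm_mult[of "e x"] ne mult_1_left
      by (rule order_trans[OF norm_triangle_ineq add_right_mono[OF norm_triangle_ineq]])
    also have "\<dots> \<le> k\<^sup>2 * h x + 2 * \<bar>k\<bar> * h x + 6 * h x"
      using b1[of x] b2[of x] by (intro add_mono) (simp_all add: norm_mult norm_power b0 mult_left_mono)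
    also have "\<dots> = ?C * h x" by (simp add: algebra_simps)
    finally show ?thesis by (simp add: h_def)
  qed
  show thesis by (rule that[OF d1 d2 c B0 B1 B2])
qed

lemma partial_tensor:
  assumes "\<And>x. (p has_vector_derivative p' x) (at x)"
  shows "partial_x (\<lambda>x y. c * (p x * q y)) = (\<lambda>x y. c * (p' x * q y))"
    and "partial_y (\<lambda>x y. c * (q x * p y)) = (\<lambda>x y. c * (q x * p' y))"
    and "(\<lambda>s. c * (p s * q y)) differentiable (at x)"
    and "(\<lambda>s. c * (q x * p s)) differentiable (at y)"
proof -
  have x: "((\<lambda>s. c * (p s * q y)) has_vector_derivative c * (p' x * q y)) (at x)" for x y
    by (intro has_vector_derivative_mult_right has_vector_derivative_mult_left assms)
  have y: "((\<lambda>s. c * (q x * p s)) has_vector_derivative c * (q x * p' y)) (at y)" for x y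
    by (intro has_vector_derivative_mult_right assms)
  show "partial_x (\<lambda>x y. c * (p x * q y)) = (\<lambda>x y. c * (p' x * q y))"
    unfolding partial_x_def by (intro ext vector_derivative_at x)
  show "partial_y (\<lambda>x y. c * (q x * p y)) = (\<lambda>x y. c * (q x * p' y))"
    unfolding partial_y_def by (intro ext vector_derivative_at y)
  show "(\<lambda>s. c * (p s * q y)) differentiable (at x)" "(\<lambda>s. c * (q x * p s)) differentiable (at y)"
    using x y by (blast intro: differentiableI_vector)+
qed

text \<open>A field that evolves purely exponentially in time. Its Fourier coefficient at \<open>(kx, ky)\<close>
  is nonzero and grows with the prescribed rate, so it separates different growth rates.\<close>

definition test_solution :: "complex \<Rightarrow> real \<Rightarrow> real \<Rightarrow> real \<Rightarrow> field2" where
  "test_solution \<nu> kx ky t x y = exp (\<nu> * t) * (profile kx x * profile ky y)"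

lemma partial_t_test_solution:
  "((\<lambda>s. test_solution \<nu> kx ky s x y) has_vector_derivative \<nu> * test_solution \<nu> kx ky t x y) (at t)"
  using has_vector_derivative_mult_left[OF exp_affine_has_vector_derivative[of 0 \<nu> t]]
  by (simp add: test_solution_def mult.assoc)

lemma admissible_test_solution: "admissible (test_solution \<nu> kx ky)"
proof -
  obtain p' p'' P where p: "\<And>x. (profile kx has_vector_derivative p' x) (at x)"
    "\<And>x. (p' has_vector_derivative p'' x) (at x)" "continuous_on UNIV p''"
    and P: "\<And>x. norm (profile kx x) \<le> P / (1 + x\<^sup>2)" "\<And>x. norm (p' x) \<le> P / (1 + x\<^sup>2)"
      "\<And>x. norm (p'' x) \<le> P / (1 + x\<^sup>2)"
    by (rule profile_derivatives[of kx]) blast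
  obtain q' q'' Q where q: "\<And>x. (profile ky has_vector_derivative q' x) (at x)"
    "\<And>x. (q' has_vector_derivative q'' x) (at x)" "continuous_on UNIV q''"
    and Q: "\<And>x. norm (profile ky x) \<le> Q / (1 + x\<^sup>2)" "\<And>x. norm (q' x) \<le> Q / (1 + x\<^sup>2)"
      "\<And>x. norm (q'' x) \<le> Q / (1 + x\<^sup>2)"
    by (rule profile_derivatives[of ky]) blast
  have pc: "continuous_on UNIV (profile kx)" "continuous_on UNIV p'"
    and qc: "continuous_on UNIV (profile ky)" "continuous_on UNIV q'"
    by (intro continuous_at_imp_continuous_on ballI has_vector_derivative_continuous[OF p(1)]
        has_vector_derivative_continuous[OF p(2)] has_vector_derivative_continuous[OF q(1)]
        has_vector_derivative_continuous[OF q(2)])+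
  define c where "c t = exp (\<nu> * of_real t)" for t :: real
  have c: "continuous_on UNIV c" "continuous_on UNIV (\<lambda>t. \<nu> * c t)"
    unfolding c_def by (intro continuous_intros)+
  have u: "test_solution \<nu> kx ky = (\<lambda>t x y. c t * (profile kx x * profile ky y))"
    by (intro ext) (simp add: test_solution_def c_def)
  have "partial_t (test_solution \<nu> kx ky) = (\<lambda>t x y. \<nu> * test_solution \<nu> kx ky t x y)"
    unfolding partial_t_def by (intro ext vector_derivative_at partial_t_test_solution)
  then have ut: "partial_t (test_solution \<nu> kx ky) = (\<lambda>t x y. (\<nu> * c t) * (profile kx x * profile ky y))"
    by (simp add: u mult.assoc)
  note D = decaying0_tensor[OF c(1)]
  have D': "decaying0 (partial_t (test_solution \<nu> kx ky))"
    unfolding ut by (rule decaying0_tensor[OF c(2) pc(1) qc(1) P(1) Q(1)])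
  have dt: "(\<lambda>s. test_solution \<nu> kx ky s x y) differentiable (at t)" for t x y
    by (rule differentiableI_vector[OF partial_t_test_solution])
  \<comment> \<open>All fields occurring in \<open>decaying 2\<close> are again tensor products of derivatives of the profiles.\<close>
  note px = partial_tensor[OF p(1)] partial_tensor[OF p(2)]
  note qx = partial_tensor[OF q(1)] partial_tensor[OF q(2)]
  have "decaying 2 (test_solution \<nu> kx ky)"
    unfolding numeral_2_eq_2 decaying.simps u px qx
    by (intro conjI allI px qx D pc qc p(3) q(3)) (rule P Q)+
  then show ?thesis unfolding admissible_def using dt D' by blast
qed

text \<open>The oscillations cancel, and the remaining integral is
  \<open>(\<integral> dx / (1 + x\<^sup>2))\<^sup>2 = \<pi>\<^sup>2\<close>.\<close>

lemma fourier_test_solution_nonzero: "fourier (test_solution \<nu> kx ky t) kx ky \<noteq> 0"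
proof -
  let ?h = "\<lambda>x::real. 1 / (1 + x\<^sup>2)"
  have pi: "(LINT x|lborel. ?h x) = pi"
    using LBINT_inverse_1_plus_square
    by (simp add: interval_lebesgue_integral_def set_lebesgue_integral_def einterval_def inverse_eq_divide)
  have "wave kx ky x y * test_solution \<nu> kx ky t x y = exp (\<nu> * t) * of_real (1 / ((1 + x\<^sup>2) * (1 + y\<^sup>2)))" for x y
  proof -
    have "wave kx ky x y * (exp (\<i> * kx * x) * exp (\<i> * ky * y)) = 1"
      unfolding wave_def exp_add[symmetric] by (simp add: algebra_simps)
    moreover have "wave kx ky x y * test_solution \<nu> kx ky t x y = exp (\<nu> * t) *
        (wave kx ky x y * (exp (\<i> * kx * x) * exp (\<i> * ky * y))) * (of_real (?h x) * of_real (?h y))"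
      unfolding test_solution_def profile_def by (simp only: ac_simps)
    ultimately show ?thesis by simp
  qed
  then have "fourier (test_solution \<nu> kx ky t) kx ky = (LINT z|(lborel :: (real \<times> real) measure).
      exp (\<nu> * t) * of_real (1 / ((1 + (fst z)\<^sup>2) * (1 + (snd z)\<^sup>2))))"
    unfolding fourier_alt by presburger
  also have "\<dots> = exp (\<nu> * t) * of_real (LINT z|(lborel :: (real \<times> real) measure). 1 / ((1 + (fst z)\<^sup>2) * (1 + (snd z)\<^sup>2)))"
    by (simp only: integral_mult_right_zero integral_complex_of_real)
  also have "(LINT z|(lborel :: (real \<times> real) measure). 1 / ((1 + (fst z)\<^sup>2) * (1 + (snd z)\<^sup>2))) = pi * pi"
  proof -
    have "(LINT z|(lborel :: (real \<times> real) measure). 1 / ((1 + (fst z)\<^sup>2) * (1 + (snd z)\<^sup>2))) =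
        (LINT x|lborel. LINT y|lborel. 1 / ((1 + (fst (x, y))\<^sup>2) * (1 + (snd (x, y))\<^sup>2)))"
      by (subst lborel_pair.integral_fst'; simp only: lborel_prod integrable_weight)
    also have "\<dots> = (LINT x|lborel. LINT y|lborel. ?h x * ?h y)" by simp
    also have "\<dots> = (LINT x|lborel. ?h x * pi)"
      by (simp only: integral_mult_right_zero pi)
    also have "\<dots> = pi * pi"
      by (simp only: integral_mult_left_zero pi)
    finally show ?thesis .
  qed
  finally show ?thesis by simp
qed

section \<open>The growth rate\<close>

text \<open>For \<open>S\<close> the symbol, the transformed equation \<open>\<i> w + S v = 0\<close> is solved by
  \<open>w = \<i> S v\<close>, where \<open>v\<close> is the Fourier coefficient and \<open>w\<close> its time derivative.\<close>

lemma is_growth_rate_symbol: "is_growth_rate ax ay b \<sigma> kx ky (\<i> * layer_symbol ax ay b \<sigma> kx ky)"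
  unfolding is_growth_rate_def
proof (intro allI impI)
  fix u t assume u: "admissible u"
  let ?S = "layer_symbol ax ay b \<sigma> kx ky"
  note d = fourier_has_vector_derivative[OF u, of kx ky t]
  have "fourier (layer_lhs ax ay b \<sigma> u t) kx ky = 0 \<longleftrightarrow>
      fourier (partial_t u t) kx ky = \<i> * ?S * fourier (u t) kx ky"
  proof -
    have "\<i> * w + v = 0 \<longleftrightarrow> w = \<i> * v" for v w :: complex
      by (auto simp: complex_eq_iff)
    then show ?thesis unfolding fourier_layer_lhs[OF u] by (simp add: mult.assoc)
  qed
  also have "\<dots> \<longleftrightarrow> ((\<lambda>s. fourier (u s) kx ky) has_vector_derivative \<i> * ?S * fourier (u t) kx ky) (at t)"
    using d vector_derivative_unique_at by metis
  finally show "fourier (layer_lhs ax ay b \<sigma> u t) kx ky = 0 \<longleftrightarrow>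
    ((\<lambda>s. fourier (u s) kx ky) has_vector_derivative \<i> * ?S * fourier (u t) kx ky) (at t)" .
qed

text \<open>One of the two rates is realized by its own test solution at time 0, where the other rate
  predicts the same derivative of a nonzero coefficient.\<close>

lemma is_growth_rate_unique:
  assumes "is_growth_rate ax ay b \<sigma> kx ky \<mu>" "is_growth_rate ax ay b \<sigma> kx ky \<nu>"
  shows "\<mu> = \<nu>"
proof -
  let ?u = "test_solution \<nu> kx ky"
  have "partial_t ?u 0 = (\<lambda>x y. \<nu> * ?u 0 x y + 0 * ?u 0 x y)"
    unfolding partial_t_def by (simp add: vector_derivative_at[OF partial_t_test_solution])
  moreover have "decays (?u 0)"
    by (rule regularD(1)[OF admissible_regular(1)[OF admissible_test_solution]])
  ultimately have "fourier (partial_t ?u 0) kx ky = \<nu> * fourier (?u 0) kx ky"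
    by (simp only: fourier_lincomb) simp
  with fourier_has_vector_derivative[OF admissible_test_solution, of \<nu> kx ky kx ky 0]
  have d: "((\<lambda>s. fourier (?u s) kx ky) has_vector_derivative \<nu> * fourier (?u 0) kx ky) (at 0)"
    by simp
  then have "((\<lambda>s. fourier (?u s) kx ky) has_vector_derivative \<mu> * fourier (?u 0) kx ky) (at 0)"
    using assms admissible_test_solution unfolding is_growth_rate_def by blast
  then have "\<mu> * fourier (?u 0) kx ky = \<nu> * fourier (?u 0) kx ky"
    using d by (rule vector_derivative_unique_at)
  then show ?thesis
    using fourier_test_solution_nonzero[of \<nu> kx ky 0] by simp
qed

lemma growth_rate_eq: "growth_rate ax ay b \<sigma> kx ky = \<i> * layer_symbol ax ay b \<sigma> kx ky"
  unfolding growth_rate_def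
  by (rule the_equality, rule is_growth_rate_symbol, erule is_growth_rate_unique, rule is_growth_rate_symbol)

section \<open>Sign of the growth rate\<close>

text \<open>After the rescaling \<open>X = \<surd>ax kx\<close>, \<open>Y = \<surd>ay ky\<close>, the two operators have, up to a
  common factor, the symbols \<open>P = X - m Y\<close> and \<open>Q = Y - m X\<close> with \<open>m = \<tau> B / 2\<close>. The quadratic form
  \<open>P\<^sup>2 + Q\<^sup>2 + B P Q\<close> is symmetric in \<open>P\<close> and \<open>Q\<close>, so it is diagonal in \<open>P + Q\<close> and
  \<open>P - Q\<close>, which here are multiples \<open>(1 - m) (X + Y)\<close> and \<open>(1 + m) (X - Y)\<close> of
  the real numbers \<open>X \<plusminus> Y\<close>. The weights are real, and all complex
  numbers are confined to two squares.\<close>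

lemma layer_symbol_diagonal:
  fixes ax ay b \<sigma> kx ky :: real
  assumes "ax > 0" "ay > 0"
  defines "B \<equiv> b / (sqrt ax * sqrt ay)" and "X \<equiv> sqrt ax * kx" and "Y \<equiv> sqrt ay * ky"
    and "\<tau> \<equiv> exp (\<i> * pi / 4) * complex_of_real \<sigma>"
  shows "layer_symbol ax ay b \<sigma> kx ky =
    - (of_real ((1 + B / 2) * (X + Y)\<^sup>2 / 2) * ((1 - \<tau> * of_real (B / 2)) / (1 + \<tau>))\<^sup>2
       + of_real ((1 - B / 2) * (X - Y)\<^sup>2 / 2) * ((1 + \<tau> * of_real (B / 2)) / (1 + \<tau>))\<^sup>2)"
proof -
  define m where "m = \<tau> * of_real (B / 2)"
  define c where "c = prefactor \<sigma>"
  have c: "1 / (1 + \<tau>) = c" by (simp add: c_def prefactor_def \<tau>_def)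
  define p where "p = complex_of_real (sqrt ax)"
  define q where "q = complex_of_real (sqrt ay)"
  have p2: "p * p = ax" "q * q = ay" and nz: "p \<noteq> 0" "q \<noteq> 0"
    using assms(1,2) by (simp_all add: p_def q_def flip: of_real_mult)
  have B: "of_real b = of_real B * p * q"
    using nz by (simp add: B_def p_def q_def)
  have skews: "p * skew ax b \<sigma> = m * q" "q * skew ay b \<sigma> = m * p"
  proof -
    have "skew ax b \<sigma> = m * q / p" "skew ay b \<sigma> = m * p / q"
      unfolding skew_def m_def \<tau>_def using nz B
      by (simp_all add: p2[symmetric] field_simps)
    then show "p * skew ax b \<sigma> = m * q" "q * skew ay b \<sigma> = m * p" using nz by simp_all
  qed
  define sx sy where "sx = p * symbol_x ax b \<sigma> kx ky" and "sy = q * symbol_y ay b \<sigma> kx ky"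
  have sx: "sx = c * \<i> * (of_real X - m * of_real Y)"
  proof -
    have "sx = c * \<i> * (p * kx - (p * skew ax b \<sigma>) * ky)"
      by (simp add: sx_def symbol_x_def c_def algebra_simps)
    then show ?thesis unfolding skews by (simp add: X_def Y_def p_def q_def)
  qed
  have sy: "sy = c * \<i> * (of_real Y - m * of_real X)"
  proof -
    have "sy = c * \<i> * (q * ky - (q * skew ay b \<sigma>) * kx)"
      by (simp add: sy_def symbol_y_def c_def algebra_simps)
    then show ?thesis unfolding skews by (simp add: X_def Y_def p_def q_def)
  qed
  have "layer_symbol ax ay b \<sigma> kx ky = sx\<^sup>2 + sy\<^sup>2 + of_real B * sx * sy"
    unfolding layer_symbol_def sx_def sy_def p2[symmetric] B
    by (simp add: power2_eq_square algebra_simps)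
  also have "\<dots> = - (of_real ((1 + B / 2) * (X + Y)\<^sup>2 / 2) * (c * (1 - m))\<^sup>2
       + of_real ((1 - B / 2) * (X - Y)\<^sup>2 / 2) * (c * (1 + m))\<^sup>2)"
    unfolding sx sy by (simp add: power2_eq_square field_simps)
  finally show ?thesis
    unfolding m_def[symmetric] by (simp only: c[symmetric] times_divide_eq_left mult_1_left)
qed

lemma exp_i_pi_quarter: "exp (\<i> * pi / 4) = Complex (sqrt 2 / 2) (sqrt 2 / 2)"
proof -
  have "exp (\<i> * pi / 4) = cis (pi / 4)" by (simp add: cis_conv_exp)
  then show ?thesis by (simp add: complex_eq_iff cos_45 sin_45)
qed

text \<open>Put \<open>a = \<sigma> / \<surd>2\<close>, so \<open>\<tau> = a + \<i> a\<close>. Up to a positive factor the quotient is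
  \<open>z = (1 - \<tau> \<beta>) (1 + cnj \<tau>)\<close>, with \<open>Im z = - (1 + \<beta>) a \<le> 0\<close>. Since
  \<open>Im (z\<^sup>2) = 2 Re z Im z\<close>, it suffices that \<open>Re z \<ge> 0\<close>, which is the condition assumed.\<close>

lemma Im_mode_le_0:
  fixes \<sigma> \<beta> :: real
  assumes "\<sigma> > 0" "-1 \<le> \<beta>"
    and cond: "0 \<le> 1 + (1 - \<beta>) * (sqrt 2 / 2 * \<sigma>) - \<beta> * \<sigma>\<^sup>2"
  defines "\<tau> \<equiv> exp (\<i> * pi / 4) * complex_of_real \<sigma>"
  shows "Im (((1 - \<tau> * of_real \<beta>) / (1 + \<tau>))\<^sup>2) \<le> 0"
proof -
  define a where "a = sqrt 2 / 2 * \<sigma>"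
  have a: "a > 0" "2 * a\<^sup>2 = \<sigma>\<^sup>2"
    using assms(1) by (simp_all add: a_def power_mult_distrib power_divide)
  have \<tau>: "\<tau> = Complex a a"
    by (simp add: \<tau>_def exp_i_pi_quarter a_def complex_eq_iff)
  define z where "z = (1 - \<tau> * of_real \<beta>) * cnj (1 + \<tau>)"
  have re: "Re z = 1 + (1 - \<beta>) * a - \<beta> * (2 * a\<^sup>2)" and im: "Im z = - ((1 + \<beta>) * a)"
    by (simp_all add: z_def \<tau> algebra_simps power2_eq_square)
  have "(1 - \<tau> * of_real \<beta>) / (1 + \<tau>) = z / of_real ((norm (1 + \<tau>))\<^sup>2)"
    unfolding z_def by (subst complex_div_cnj) simp
  then have "Im (((1 - \<tau> * of_real \<beta>) / (1 + \<tau>))\<^sup>2) = 2 * Re z * Im z / ((norm (1 + \<tau>))\<^sup>2)\<^sup>2"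
    by (simp only: power_divide of_real_power[symmetric] Im_divide_of_real Im_power2)
  also have "\<dots> \<le> 0"
  proof (rule divide_nonpos_nonneg)
    have "Re z \<ge> 0" using cond unfolding re a(2) a_def[symmetric] .
    moreover have "Im z \<le> 0" using a(1) assms(2) by (simp add: im)
    ultimately show "2 * Re z * Im z \<le> 0" by (simp add: mult_nonneg_nonpos)
  qed simp
  finally show ?thesis .
qed

text \<open>For \<open>b > 0\<close> the threshold \<open>sigma1 b\<close> is the positive root in \<open>\<sigma>\<close> of
  the right-hand side at \<open>\<beta> = b / 2\<close>, which is positive at \<open>\<sigma> = 0\<close> and concave in \<open>\<sigma>\<close>. The
  right-hand side decreases in \<open>\<beta>\<close>, so all smaller, also negative, values of \<open>\<beta>\<close> are covered.\<close>

lemma sigma1_condition: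
  assumes "\<sigma> > 0" "0 \<le> b" "ereal \<sigma> < sigma1 b" "\<beta> \<le> b / 2"
  shows "0 \<le> 1 + (1 - \<beta>) * (sqrt 2 / 2 * \<sigma>) - \<beta> * \<sigma>\<^sup>2"
proof -
  define a where "a = sqrt 2 / 2 * \<sigma>"
  have a: "a > 0" "\<sigma>\<^sup>2 = 2 * a\<^sup>2" "\<sigma> = sqrt 2 * a"
    using assms(1) by (simp_all add: a_def power_mult_distrib power_divide)
  have "0 \<le> 1 + (1 - b / 2) * a - b / 2 * (2 * a\<^sup>2)"
  proof (cases "b = 0")
    case True
    then show ?thesis using a(1) by simp
  next
    case False
    with assms(2) have b: "b > 0" by simp
    define D where "D = sqrt (b\<^sup>2 + 12 * b + 4)"
    have D2: "D\<^sup>2 = b\<^sup>2 + 12 * b + 4" and D0: "D \<ge> 0"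
      using b by (simp_all add: D_def add_nonneg_nonneg)
    have "sqrt 2 * a < sqrt 2 * ((2 - b + D) / (4 * b))"
      using assms(3) False by (simp add: sigma1_def a(3) D_def)
    then have "a < (2 - b + D) / (4 * b)" by (rule mult_left_less_imp_less) simp
    \<comment> \<open>Both roots of the quadratic polynomial in \<open>a\<close> have \<open>4 b a = 2 - b \<plusminus> D\<close>.\<close>
    then have up: "4 * b * a - (2 - b) < D"
      using b by (simp add: pos_less_divide_eq algebra_simps)
    have "(2 - b)\<^sup>2 \<le> D\<^sup>2" unfolding D2 using b by (simp add: power2_eq_square algebra_simps)
    then have "2 - b \<le> D" using D0 by (rule power2_le_imp_le)
    then have low: "- D \<le> 4 * b * a - (2 - b)"
      using b a(1) mult_pos_pos[of "4 * b" a] by linarith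
    have "\<bar>4 * b * a - (2 - b)\<bar> \<le> \<bar>D\<bar>" using up low by linarith
    then have "(4 * b * a - (2 - b))\<^sup>2 \<le> D\<^sup>2" by (rule abs_le_square_iff[THEN iffD1])
    then have "0 \<le> (16 * b) * (1 + (1 - b / 2) * a - b / 2 * (2 * a\<^sup>2))"
      unfolding D2 by (simp add: power2_eq_square algebra_simps)
    then show ?thesis using b by (simp only: zero_le_mult_iff) linarith
  qed
  moreover have "\<beta> * (a + 2 * a\<^sup>2) \<le> b / 2 * (a + 2 * a\<^sup>2)"
    using assms(4) a(1) by (intro mult_right_mono) auto
  ultimately show ?thesis
    unfolding a(2) a_def[symmetric] by (simp add: algebra_simps)
qed

lemma beta_tilde_eq:
  assumes "ax > 0" "ay > 0"
  shows "beta_tilde ax ay b = b / (sqrt ax * sqrt ay)"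
proof -
  have "x powr (- 1 / 2) = 1 / sqrt x" if "x > 0" for x :: real
    using that powr_minus_divide[of x "1 / 2"] by (simp add: powr_half_sqrt)
  then show ?thesis using assms by (simp add: beta_tilde_def)
qed

text \<open>By \<open>layer_symbol_diagonal\<close> the real part of the growth rate is a combination, with the
  weights \<open>1 \<plusminus> B / 2\<close>, of the imaginary parts of the two squares. Ellipticity makes the weights
  positive, and the squares correspond to \<open>\<beta> = B / 2\<close> and \<open>\<beta> = - B / 2\<close>.\<close>

lemma layer_stable:
  assumes ax: "ax > 0" and ell: "ax * ay > b\<^sup>2" and \<sigma>: "\<sigma> > 0"
    and M: "\<bar>beta_tilde ax ay b\<bar> \<le> M" "ereal \<sigma> < sigma1 M"
  shows "Re (growth_rate ax ay b \<sigma> kx ky) \<le> 0"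
proof -
  have "0 < ax * ay" using ell zero_le_power2[of b] by linarith
  then have ay: "ay > 0" using ax by (simp add: zero_less_mult_iff)
  define B where "B = b / (sqrt ax * sqrt ay)"
  have BM: "\<bar>B\<bar> \<le> M" using M(1) by (simp add: beta_tilde_eq[OF ax ay] B_def)
  have "B\<^sup>2 < 1"
    using ell \<open>0 < ax * ay\<close> ax ay by (simp add: B_def power_divide power_mult_distrib)
  then have B1: "\<bar>B\<bar> < 1" by (simp add: abs_square_less_1)
  define \<tau> where "\<tau> = exp (\<i> * pi / 4) * complex_of_real \<sigma>"
  have mode: "Im (((1 - \<tau> * of_real \<beta>) / (1 + \<tau>))\<^sup>2) \<le> 0" if "\<bar>\<beta>\<bar> \<le> \<bar>B\<bar> / 2" for \<beta>
    unfolding \<tau>_def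
    by (rule Im_mode_le_0[OF \<sigma> _ sigma1_condition[OF \<sigma> _ M(2)]]) (use that BM B1 in linarith)+
  have m1: "Im (((1 - \<tau> * of_real (B / 2)) / (1 + \<tau>))\<^sup>2) \<le> 0" by (rule mode) simp
  have m2: "Im (((1 + \<tau> * of_real (B / 2)) / (1 + \<tau>))\<^sup>2) \<le> 0" using mode[of "- (B / 2)"] by simp
  define X Y where "X = sqrt ax * kx" and "Y = sqrt ay * ky"
  have Re_im: "Re (\<i> * (- (of_real u * v + of_real w * z))) = u * Im v + w * Im z"
    for u w :: real and v z :: complex
    by simp
  have "Re (growth_rate ax ay b \<sigma> kx ky) =
      (1 + B / 2) * (X + Y)\<^sup>2 / 2 * Im (((1 - \<tau> * of_real (B / 2)) / (1 + \<tau>))\<^sup>2)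
      + (1 - B / 2) * (X - Y)\<^sup>2 / 2 * Im (((1 + \<tau> * of_real (B / 2)) / (1 + \<tau>))\<^sup>2)"
    unfolding growth_rate_eq layer_symbol_diagonal[OF ax ay] B_def[symmetric] \<tau>_def[symmetric]
      X_def[symmetric] Y_def[symmetric] Re_im ..
  also have "\<dots> \<le> 0"
    using B1 by (intro add_nonpos_nonpos mult_nonneg_nonpos m1 m2 divide_nonneg_nonneg mult_nonneg_nonneg) auto
  finally show ?thesis .
qed

theorem mainTheorem2:
  fixes N :: nat and \<alpha>x \<alpha>y \<beta> :: "nat \<Rightarrow> real" and \<sigma> :: real
  assumes "N \<ge> 1"
    and "\<And>j. j \<in> {1..N} \<Longrightarrow> sgn (\<alpha>x j) = sgn (\<alpha>y j)"
    and "\<And>j. j \<in> {1..N} \<Longrightarrow> \<alpha>x j > 0"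
    and "\<And>j. j \<in> {1..N} \<Longrightarrow> \<alpha>x j * \<alpha>y j > (\<beta> j)\<^sup>2"
    and "\<sigma> > 0"
    and "ereal \<sigma> < sigma1 (Max ((\<lambda>j. \<bar>beta_tilde (\<alpha>x j) (\<alpha>y j) (\<beta> j)\<bar>) ` {1..N}))"
  shows "\<forall>j \<in> {1..N}. \<forall>kx ky. Re (growth_rate (\<alpha>x j) (\<alpha>y j) (\<beta> j) \<sigma> kx ky) \<le> 0"
proof (intro ballI allI)
  fix j kx ky assume j: "j \<in> {1..N}"
  show "Re (growth_rate (\<alpha>x j) (\<alpha>y j) (\<beta> j) \<sigma> kx ky) \<le> 0"
    by (rule layer_stable[OF assms(3)[OF j] assms(4)[OF j] assms(5) _ assms(6)])
       (use j in \<open>auto intro!: Max_ge\<close>)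
qed

end
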